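(* Let $\mathcal{G}=(V,E)$ be a strongly connected directed graph with $N$ nodes and no dangling nodes. Then for every damping factor $\lambda\in(0,1)$ there is a unique fixed point of the PageRank as a function $PR_\lambda:\Delta_N^+\to\Delta_N^+$. Furthermore, this fixed point is the left-hand Perron vector of the matrix $P_A$.
   Context: $\mathcal{G}=(V,E)$ is a directed graph with $V=\{1,\dots,N\}$ and adjacency matrix $A=(a_{ij})$, $a_{ij}=1$ if $(i,j)\in E$ and $0$ otherwise (self-loops are allowed). A dangling node is a node with no outgoing links. $\mathcal{G}$ is strongly connected if for every ordered pair of nodes $(i,j)$ there is a directed path from $i$ to $j$. $P_A=(p_{ij})$ is the row-stochastic matrix $p_{ij}=a_{ij}/\sum_k a_{ik}$. $\Delta_N^+=\{\mathbf{x}\in\mathbb{R}^{N\times1}: x_1+\cdots+x_N=1,\ x_i>0\ \forall i\}$. For $\lambda\in(0,1)$, the PageRank as a function of the personalization vector is $PR_\lambda(\mathbf{v})=\pi$ with $\pi^T=\mathbf{v}^TX(\lambda)$, $X(\lambda)=(1-\lambda)(I_N-\lambda P_A)^{-1}$; it maps $\Delta_N^+$ into itself. Left-hand Perron vector: for a non-negative irreducible matrix $M$, the unique vector $\mathbf{q}$ with $\mathbf{q}^TM=\rho(M)\mathbf{q}^T$, $\mathbf{q}>0$, and entries summing to $1$, where $\rho(M)$ is the spectral radius. *)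

theory Defs
  imports "HOL-Analysis.Analysis" "Graph_Theory.Graph_Theory"
begin

text \<open>
  The nodes \<open>1, \<dots>, N\<close> are the elements of a finite type \<open>'n\<close>, so that \<open>N = CARD('n)\<close>.
  A graph is a \<open>pair_pre_digraph\<close> (arcs are ordered pairs of nodes, self-loops are
  allowed) whose vertex set is all of \<open>'n\<close>. The paths of \<open>strongly_connected\<close> include the
  empty path from a node to itself.
\<close>

definition adjacency_matrix :: "'n::finite pair_pre_digraph \<Rightarrow> real^'n^'n" where
  "adjacency_matrix G = (\<chi> i j. if (i, j) \<in> parcs G then 1 else 0)"

definition dangling :: "'n pair_pre_digraph \<Rightarrow> 'n \<Rightarrow> bool" where
  "dangling G i \<longleftrightarrow> i \<in> pverts G \<and> out_arcs (with_proj G) i = {}"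

definition transition_matrix :: "'n::finite pair_pre_digraph \<Rightarrow> real^'n^'n" where
  "transition_matrix G =
     (\<chi> i j. adjacency_matrix G $ i $ j / (\<Sum>k\<in>UNIV. adjacency_matrix G $ i $ k))"

definition open_simplex :: "(real^'n::finite) set" where
  "open_simplex = {x. (\<Sum>i\<in>UNIV. x $ i) = 1 \<and> (\<forall>i. x $ i > 0)}"

definition pagerank_matrix :: "'n::finite pair_pre_digraph \<Rightarrow> real \<Rightarrow> real^'n^'n" where
  "pagerank_matrix G l = (1 - l) *\<^sub>R matrix_inv (mat 1 - l *\<^sub>R transition_matrix G)"

definition pagerank :: "'n::finite pair_pre_digraph \<Rightarrow> real \<Rightarrow> real^'n \<Rightarrow> real^'n" where
  "pagerank G l v = v v* pagerank_matrix G l"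

text \<open>
  The spectral radius of a real matrix is taken over its complex eigenvalues. There are
  finitely many of them and at least one, so the supremum is a maximum.
\<close>

definition eigenvalue_of :: "complex^'n^'n \<Rightarrow> complex \<Rightarrow> bool" where
  "eigenvalue_of M \<mu> \<longleftrightarrow> (\<exists>x. x \<noteq> 0 \<and> M *v x = \<mu> *s x)"

definition spectral_radius :: "real^'n^'n \<Rightarrow> real" where
  "spectral_radius M =
     Sup {cmod \<mu> | \<mu>. eigenvalue_of (\<chi> i j. complex_of_real (M $ i $ j)) \<mu>}"

text \<open>Being the unique vector with the defining properties is part of the predicate.\<close>

definition is_left_perron_vector :: "real^'n^'n \<Rightarrow> real^'n::finite \<Rightarrow> bool" where
  "is_left_perron_vector M q \<longleftrightarrow>
     {p. p v* M = spectral_radius M *\<^sub>R p \<and> (\<forall>i. p $ i > 0) \<and> (\<Sum>i\<in>UNIV. p $ i) = 1} = {q}"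

end

theory Submission
  imports Defs
begin

text \<open>
  Multiplying \<open>\<pi>\<^sup>T = v\<^sup>T X(\<lambda>)\<close> by \<open>I - \<lambda> P\<close> turns it into
  \<open>\<pi>\<^sup>T = \<lambda> \<pi>\<^sup>T P + (1 - \<lambda>) v\<^sup>T\<close>, so the fixed points of the PageRank are exactly the
  left fixed vectors of \<open>P\<close>. Right multiplication by the row-stochastic \<open>P\<close> preserves the
  sum of the entries; hence an inequality \<open>z \<le> \<lambda> z P\<close> with \<open>z \<ge> 0\<close> forces \<open>z = 0\<close>, and
  \<open>z \<le> z P\<close> forces \<open>z = z P\<close>. The former makes \<open>I - \<lambda> P\<close> invertible and, applied to the
  negative part of \<open>\<pi>\<close>, makes \<open>\<pi>\<close> positive. As \<open>P - I\<close> is singular, there is some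
  \<open>y \<noteq> 0\<close> with \<open>y = y P\<close>; the latter makes \<open>\<bar>y\<bar>\<close> fixed as well, and irreducibility
  makes it positive.
\<close>

section \<open>Row vectors and row-stochastic matrices\<close>

lemma invertible_iff_left_kernel_trivial:
  fixes A :: "'a::field^'n^'n"
  shows "invertible A \<longleftrightarrow> (\<forall>x. x v* A = 0 \<longrightarrow> x = 0)"
  unfolding invertible_right_inverse
  using left_invertible_transpose[of A] matrix_left_invertible_ker[of "transpose A"]
  by simp

definition row_stochastic :: "real^'n^'m \<Rightarrow> bool" where
  "row_stochastic M \<longleftrightarrow> (\<forall>i j. M $ i $ j \<ge> 0) \<and> (\<forall>i. (\<Sum>j\<in>UNIV. M $ i $ j) = 1)"

text \<open>Irreducibility is put as reachability in the graph of positive entries, so that graph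
  paths transfer directly and positivity can be proved by induction along them. The closure is
  reflexive, matching the empty paths in \<open>strongly_connected\<close>; every 1x1 matrix
  therefore qualifies, even 0.\<close>

definition irreducible_matrix :: "real^'n^'n \<Rightarrow> bool" where
  "irreducible_matrix M \<longleftrightarrow> (\<forall>i j. (i, j) \<in> {(i, j). M $ i $ j > 0}\<^sup>*)"

lemma row_stochastic_mult_one:
  assumes "row_stochastic M"
  shows "M *v 1 = 1"
  using assms by (simp add: row_stochastic_def vec_eq_iff matrix_vector_mult_def)

lemma sum_vector_matrix_mult_row_stochastic:
  assumes "row_stochastic M"
  shows "(\<Sum>j\<in>UNIV. (x v* M) $ j) = (\<Sum>i\<in>UNIV. x $ i)"
  using dot_lmul_matrix[of x M 1] row_stochastic_mult_one[OF assms]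
  by (simp add: inner_vec_def)

lemma vector_matrix_mult_mono:
  fixes M :: "real^'n^'m"
  assumes "row_stochastic M" and "\<And>i. x $ i \<le> y $ i"
  shows "(x v* M) $ j \<le> (y v* M) $ j"
  using assms
  by (auto simp: row_stochastic_def vector_matrix_mult_def intro!: sum_mono mult_right_mono)

lemma abs_vector_matrix_mult_le:
  fixes M :: "real^'n^'m"
  assumes "row_stochastic M"
  shows "\<bar>(x v* M) $ j\<bar> \<le> ((\<chi> i. \<bar>x $ i\<bar>) v* M) $ j"
proof -
  have "\<bar>(x v* M) $ j\<bar> \<le> (\<Sum>i\<in>UNIV. \<bar>x $ i * M $ i $ j\<bar>)"
    unfolding vector_matrix_mult_def by (simp add: sum_abs)
  also have "\<dots> = ((\<chi> i. \<bar>x $ i\<bar>) v* M) $ j"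
    using assms by (simp add: row_stochastic_def vector_matrix_mult_def abs_mult)
  finally show ?thesis .
qed

lemma vector_le_contraction_eq_0:
  fixes M :: "real^'n^'n"
  assumes M: "row_stochastic M" and "l < 1"
    and nonneg: "\<And>i. z $ i \<ge> 0" and le: "\<And>i. z $ i \<le> l * (z v* M) $ i"
  shows "z = 0"
proof -
  let ?s = "\<Sum>i\<in>UNIV. z $ i"
  have "?s \<le> (\<Sum>i\<in>UNIV. l * (z v* M) $ i)"
    by (intro sum_mono le)
  also have "\<dots> = l * ?s"
    using sum_vector_matrix_mult_row_stochastic[OF M, of z] by (simp flip: sum_distrib_left)
  finally have "(1 - l) * ?s \<le> 0"
    by (simp add: algebra_simps)
  then have "?s \<le> 0"
    using \<open>l < 1\<close> by (simp add: mult_le_0_iff)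
  moreover have "?s \<ge> 0"
    by (intro sum_nonneg nonneg)
  ultimately have "?s = 0"
    by simp
  then show ?thesis
    using nonneg by (simp add: sum_nonneg_eq_0_iff vec_eq_iff)
qed

text \<open>The entries of \<open>z v* M - z\<close> are nonnegative and sum to 0.\<close>

lemma subinvariant_imp_invariant:
  fixes M :: "real^'n^'n"
  assumes M: "row_stochastic M" and le: "\<And>i. z $ i \<le> (z v* M) $ i"
  shows "z v* M = z"
proof -
  have "(\<Sum>i\<in>UNIV. (z v* M) $ i - z $ i) = 0"
    using sum_vector_matrix_mult_row_stochastic[OF M, of z] by (simp add: sum_subtractf)
  then have "\<forall>i. (z v* M) $ i - z $ i = 0"
    using le by (subst (asm) sum_nonneg_eq_0_iff) auto
  then show ?thesis
    by (simp add: vec_eq_iff)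
qed

section \<open>Existence and uniqueness of the stationary vector\<close>

lemma abs_fixed_vector:
  fixes M :: "real^'n^'n"
  assumes "row_stochastic M" and "y v* M = y"
  shows "(\<chi> i. \<bar>y $ i\<bar>) v* M = (\<chi> i. \<bar>y $ i\<bar>)"
  using assms(1)
proof (rule subinvariant_imp_invariant)
  show "(\<chi> i. \<bar>y $ i\<bar>) $ j \<le> ((\<chi> i. \<bar>y $ i\<bar>) v* M) $ j" for j
    using abs_vector_matrix_mult_le[OF assms(1), of y j] assms(2) by simp
qed

text \<open>Some entry of \<open>z\<close> is positive, and positivity spreads along positive
  entries of \<open>M\<close>: entry j of \<open>z = z v* M\<close> is at least
  \<open>z $ i * M $ i $ j\<close>.\<close>

lemma nonneg_fixed_vector_pos:
  fixes M :: "real^'n^'n"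
  assumes M: "row_stochastic M" "irreducible_matrix M" and fixed: "z v* M = z"
    and nonneg: "\<And>i. z $ i \<ge> 0" and "z \<noteq> 0"
  shows "z $ i > 0"
proof -
  obtain k where k: "z $ k > 0"
    using \<open>z \<noteq> 0\<close> nonneg by (auto simp: vec_eq_iff less_le)
  have "(k, i) \<in> {(i, j). M $ i $ j > 0}\<^sup>*"
    using M by (simp add: irreducible_matrix_def)
  then show ?thesis
  proof induction
    case base
    show ?case by (rule k)
  next
    case (step i j)
    have "0 < z $ i * M $ i $ j"
      using step by simp
    also have "\<dots> \<le> (\<Sum>i\<in>UNIV. z $ i * M $ i $ j)"
      using M nonneg by (intro member_le_sum) (auto simp: row_stochastic_def)
    also have "\<dots> = (z v* M) $ j"
      by (simp add: vector_matrix_mult_def)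
    finally show ?case
      by (simp add: fixed)
  qed
qed

text \<open>The fixed vector with entries \<open>\<bar>y $ i\<bar> - y $ i\<close> is nonnegative,
  hence zero or positive everywhere. So the entries of \<open>y\<close> are all nonnegative or all
  negative, and a nonzero \<open>y\<close> of either kind has nonzero sum. Applied to a difference
  of two stationary vectors, this gives uniqueness.\<close>

lemma fixed_vector_sum_0_imp_0:
  fixes M :: "real^'n^'n"
  assumes M: "row_stochastic M" "irreducible_matrix M" and fixed: "y v* M = y"
    and sum: "(\<Sum>i\<in>UNIV. y $ i) = 0"
  shows "y = 0"
proof (rule ccontr)
  assume "y \<noteq> 0"
  let ?a = "\<chi> i. \<bar>y $ i\<bar>"
  have fixed': "(?a - y) v* M = ?a - y"
    using abs_fixed_vector[OF M(1) fixed] fixed by (simp add: vector_matrix_mult_diff_distrib)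
  show False
  proof (cases "?a - y = 0")
    case True
    then have "y $ i \<ge> 0" for i
      by (simp add: vec_eq_iff) (metis abs_ge_zero)
    then have "y = 0"
      using sum by (simp add: sum_nonneg_eq_0_iff vec_eq_iff)
    with \<open>y \<noteq> 0\<close> show False ..
  next
    case False
    have "(?a - y) $ i > 0" for i
      by (rule nonneg_fixed_vector_pos[OF M fixed' _ False]) simp
    then have "y $ i < 0" for i
      by (fastforce simp: abs_if split: if_splits)
    then have "(\<Sum>i\<in>UNIV. y $ i) < 0"
      using sum_strict_mono[of UNIV "\<lambda>i. y $ i" "\<lambda>i. 0"] by simp
    with sum show False by simp
  qed
qed

lemma ex1_stationary_vector:
  fixes M :: "real^'n^'n"
  assumes M: "row_stochastic M" "irreducible_matrix M"
  shows "\<exists>!v. v \<in> open_simplex \<and> v v* M = v"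
proof (rule ex_ex1I)
  \<comment> \<open>The all-ones column lies in the right kernel of a square matrix, so the left
    kernel is nontrivial too; it supplies \<open>y\<close>.\<close>
  have "(mat 1 - M) *v 1 = 0"
    using row_stochastic_mult_one[OF M(1)] by (simp add: matrix_vector_mult_diff_rdistrib)
  moreover have "(1 :: real^'n) \<noteq> 0"
    by (simp add: vec_eq_iff)
  ultimately have "\<not> invertible (mat 1 - M)"
    unfolding invertible_left_inverse matrix_left_invertible_ker by blast
  then obtain y where "y \<noteq> 0" and "y v* (mat 1 - M) = 0"
    unfolding invertible_iff_left_kernel_trivial by blast
  then have y: "y v* M = y"
    by (simp add: vector_matrix_mult_diff_rdistrib)
  define z where "z = (\<chi> i. \<bar>y $ i\<bar>)"
  have z: "z v* M = z"
    unfolding z_def by (rule abs_fixed_vector[OF M(1) y])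
  have "z \<noteq> 0"
    using \<open>y \<noteq> 0\<close> by (simp add: z_def vec_eq_iff)
  have pos: "z $ i > 0" for i
    by (rule nonneg_fixed_vector_pos[OF M z _ \<open>z \<noteq> 0\<close>]) (simp add: z_def)
  define s where "s = (\<Sum>i\<in>UNIV. z $ i)"
  have "s > 0"
    unfolding s_def by (intro sum_pos pos) auto
  have "(1 / s) *\<^sub>R z \<in> open_simplex"
    using \<open>s > 0\<close> pos
    by (simp add: open_simplex_def s_def flip: sum_divide_distrib)
  moreover have "((1 / s) *\<^sub>R z) v* M = (1 / s) *\<^sub>R z"
    using z by (simp add: scaleR_vector_matrix_assoc)
  ultimately show "\<exists>v. v \<in> open_simplex \<and> v v* M = v"
    by blast
next
  fix v w
  assume "v \<in> open_simplex \<and> v v* M = v" and "w \<in> open_simplex \<and> w v* M = w"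
  then have "v - w = 0"
    by (intro fixed_vector_sum_0_imp_0[OF M])
      (auto simp: open_simplex_def sum_subtractf vector_matrix_mult_diff_distrib)
  then show "v = w" by simp
qed

section \<open>Spectral radius of a row-stochastic matrix\<close>

lemma cmod_eigenvalue_row_stochastic_le_1:
  fixes M :: "real^'n^'n"
  assumes M: "row_stochastic M"
    and eig: "eigenvalue_of (\<chi> i j. complex_of_real (M $ i $ j)) \<mu>"
  shows "cmod \<mu> \<le> 1"
proof -
  obtain x where "x \<noteq> 0" and x: "(\<chi> i j. complex_of_real (M $ i $ j)) *v x = \<mu> *s x"
    using eig by (auto simp: eigenvalue_of_def)
  \<comment> \<open>At an index where the modulus of \<open>x\<close> is largest, the eigenvalue
    equation equates \<open>\<mu>\<close> times that entry with a weighted average of entries of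
    modulus at most \<open>m\<close>.\<close>
  define m where "m = Max (range (\<lambda>j. cmod (x $ j)))"
  have le: "cmod (x $ j) \<le> m" for j
    unfolding m_def by (intro Max_ge) auto
  have "m \<in> range (\<lambda>j. cmod (x $ j))"
    unfolding m_def by (intro Max_in) auto
  then obtain i where i: "m = cmod (x $ i)"
    by blast
  obtain k where "x $ k \<noteq> 0"
    using \<open>x \<noteq> 0\<close> by (auto simp: vec_eq_iff)
  then have "m > 0"
    using le[of k] by (meson less_le_trans zero_less_norm_iff)
  have "cmod \<mu> * m = cmod (\<Sum>j\<in>UNIV. complex_of_real (M $ i $ j) * x $ j)"
    using arg_cong[OF x, of "\<lambda>y. cmod (y $ i)"]
    by (simp add: i matrix_vector_mult_def norm_mult)
  also have "\<dots> \<le> (\<Sum>j\<in>UNIV. M $ i $ j * m)"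
    using M le
    by (intro sum_norm_le) (auto simp: row_stochastic_def norm_mult intro!: mult_left_mono)
  also have "\<dots> = m"
    using M by (simp add: row_stochastic_def flip: sum_distrib_right)
  finally show ?thesis
    using \<open>m > 0\<close> by simp
qed

text \<open>All eigenvalues have modulus at most 1, and the all-ones vector attains this bound, so
  the supremum is a maximum.\<close>

lemma spectral_radius_row_stochastic:
  fixes M :: "real^'n^'n"
  assumes M: "row_stochastic M"
  shows "spectral_radius M = 1"
  unfolding spectral_radius_def
proof (rule cSup_eq_maximum)
  have "(\<Sum>j\<in>UNIV. complex_of_real (M $ i $ j)) = 1" for i
    using M by (simp add: row_stochastic_def flip: of_real_sum)
  then have "(\<chi> i j. complex_of_real (M $ i $ j)) *v 1 = 1 *s 1"
    by (simp add: vec_eq_iff matrix_vector_mult_def)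
  moreover have "(1 :: complex^'n) \<noteq> 0"
    by (simp add: vec_eq_iff)
  ultimately have "eigenvalue_of (\<chi> i j. complex_of_real (M $ i $ j)) 1"
    unfolding eigenvalue_of_def by blast
  then show "1 \<in> {cmod \<mu> |\<mu>. eigenvalue_of (\<chi> i j. complex_of_real (M $ i $ j)) \<mu>}"
    by force
qed (use cmod_eigenvalue_row_stochastic_le_1[OF M] in auto)

section \<open>The resolvent and the PageRank map\<close>

lemma invertible_resolvent:
  fixes M :: "real^'n^'n"
  assumes M: "row_stochastic M" and l: "0 \<le> l" "l < 1"
  shows "invertible (mat 1 - l *\<^sub>R M)"
  unfolding invertible_iff_left_kernel_trivial
proof (intro allI impI)
  fix y assume "y v* (mat 1 - l *\<^sub>R M) = 0"
  then have y: "y $ i = l * (y v* M) $ i" for i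
    by (simp add: vector_matrix_mult_diff_rdistrib vector_scaleR_matrix_ac vec_eq_iff)
  \<comment> \<open>The contraction argument needs nonnegative entries. Absolute values in
    \<open>y = l *\<^sub>R (y v* M)\<close>, with the triangle inequality, give the required
    inequality for the vector of moduli.\<close>
  have "(\<chi> i. \<bar>y $ i\<bar>) = 0"
  proof (rule vector_le_contraction_eq_0[OF M l(2)])
    show "(\<chi> i. \<bar>y $ i\<bar>) $ j \<le> l * ((\<chi> i. \<bar>y $ i\<bar>) v* M) $ j" for j
      using mult_left_mono[OF abs_vector_matrix_mult_le[OF M, of y j] l(1)] l(1) y[of j]
      by (simp add: abs_mult)
  qed simp
  then show "y = 0"
    by (simp add: vec_eq_iff)
qed

lemma pagerank_eq_iff:
  assumes M: "row_stochastic (transition_matrix G)" and l: "0 \<le> l" "l < 1"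
  shows "pagerank G l v = p \<longleftrightarrow> p = l *\<^sub>R (p v* transition_matrix G) + (1 - l) *\<^sub>R v"
proof -
  let ?R = "mat 1 - l *\<^sub>R transition_matrix G"
  \<comment> \<open>\<open>matrix_inv\<close> is a choice; only invertibility makes it a two-sided
    inverse.\<close>
  have inv: "?R ** matrix_inv ?R = mat 1" "matrix_inv ?R ** ?R = mat 1"
    using invertible_resolvent[OF M l] someI_ex[of "\<lambda>B. ?R ** B = mat 1 \<and> B ** ?R = mat 1"]
    unfolding invertible_def matrix_inv_def by auto
  have pr: "pagerank G l v = ((1 - l) *\<^sub>R v) v* matrix_inv ?R"
    by (simp add: pagerank_def pagerank_matrix_def vector_scaleR_matrix_ac
        scaleR_vector_matrix_assoc)
  have "pagerank G l v = p \<longleftrightarrow> p v* ?R = (1 - l) *\<^sub>R v"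
    unfolding pr
    by (metis inv vector_matrix_mul_assoc vector_matrix_mul_rid)
  also have "\<dots> \<longleftrightarrow> p = l *\<^sub>R (p v* transition_matrix G) + (1 - l) *\<^sub>R v"
    by (simp add: vector_matrix_mult_diff_rdistrib vector_scaleR_matrix_ac diff_eq_eq add.commute)
  finally show ?thesis .
qed

lemma pagerank_fixed_iff:
  assumes "row_stochastic (transition_matrix G)" and "0 < l" "l < 1"
  shows "pagerank G l v = v \<longleftrightarrow> v v* transition_matrix G = v"
proof -
  have "pagerank G l v = v \<longleftrightarrow> v = l *\<^sub>R (v v* transition_matrix G) + (1 - l) *\<^sub>R v"
    using assms by (intro pagerank_eq_iff) auto
  also have "\<dots> \<longleftrightarrow> l *\<^sub>R (v v* transition_matrix G) = l *\<^sub>R v"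
    by (auto simp: algebra_simps)
  finally show ?thesis
    using \<open>0 < l\<close> by simp
qed

lemma pagerank_in_open_simplex:
  assumes M: "row_stochastic (transition_matrix G)" and l: "0 < l" "l < 1"
    and v: "v \<in> open_simplex"
  shows "pagerank G l v \<in> open_simplex"
proof -
  let ?P = "transition_matrix G"
  define p where "p = pagerank G l v"
  have "p = l *\<^sub>R (p v* ?P) + (1 - l) *\<^sub>R v"
    using pagerank_eq_iff[OF M, of l v p] l by (simp add: p_def)
  then have p: "p $ i = l * (p v* ?P) $ i + (1 - l) * v $ i" for i
    by (metis vector_add_component vector_scaleR_component real_scaleR_def)
  have v_pos: "(1 - l) * v $ i > 0" for i
    using v l by (simp add: open_simplex_def)
  \<comment> \<open>The negative part of \<open>p\<close>. The equation for \<open>p\<close> and the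
    positivity of \<open>v\<close> give \<open>- p $ i \<le> l * (z v* ?P) $ i\<close>; the right
    side is also nonnegative, so it bounds \<open>z $ i\<close>.\<close>
  define z where "z = (\<chi> i. max 0 (- p $ i))"
  have le: "- p $ i \<le> l * (z v* ?P) $ i" for i
  proof -
    have "((- p) v* ?P) $ i \<le> (z v* ?P) $ i"
      by (rule vector_matrix_mult_mono[OF M]) (simp add: z_def)
    moreover have "((- p) v* ?P) $ i = - ((p v* ?P) $ i)"
      by (simp add: vector_matrix_mult_def sum_negf)
    ultimately have "l * - (p v* ?P) $ i \<le> l * (z v* ?P) $ i"
      using l by (intro mult_left_mono) auto
    then show ?thesis
      using p[of i] v_pos[of i] by simp
  qed
  have "z = 0"
  proof (rule vector_le_contraction_eq_0[OF M l(2)])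
    show "z $ i \<ge> 0" for i
      by (simp add: z_def)
    show "z $ i \<le> l * (z v* ?P) $ i" for i
    proof -
      have "0 \<le> (z v* ?P) $ i"
        using vector_matrix_mult_mono[OF M, of 0 z i] by (simp add: z_def)
      with le[of i] l show ?thesis
        by (simp add: z_def)
    qed
  qed
  then have nonneg: "p $ i \<ge> 0" for i
    by (simp add: z_def vec_eq_iff max_def split: if_splits)
      (metis linorder_not_le neg_0_le_iff_le order_less_imp_le)
  \<comment> \<open>Strictness comes from the term \<open>(1 - l) * v $ i\<close>.\<close>
  have "p $ i > 0" for i
  proof -
    have "0 \<le> (p v* ?P) $ i"
      using vector_matrix_mult_mono[OF M, of 0 p i] nonneg by simp
    then show ?thesis
      using p[of i] v_pos[of i] l by (simp add: add_nonneg_pos)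
  qed
  moreover have "(\<Sum>i\<in>UNIV. p $ i) = 1"
  proof -
    have "(\<Sum>i\<in>UNIV. p $ i) = (\<Sum>i\<in>UNIV. l * (p v* ?P) $ i + (1 - l) * v $ i)"
      using p by simp
    also have "\<dots> = l * (\<Sum>i\<in>UNIV. p $ i) + (1 - l)"
      using v sum_vector_matrix_mult_row_stochastic[OF M, of p]
      by (simp add: sum.distrib open_simplex_def flip: sum_distrib_left)
    finally have "(1 - l) * (\<Sum>i\<in>UNIV. p $ i) = (1 - l) * 1"
      by (simp add: algebra_simps)
    then show ?thesis
      using l by (subst (asm) mult_left_cancel) auto
  qed
  ultimately show ?thesis
    by (simp add: open_simplex_def p_def)
qed

section \<open>The transition matrix of a graph\<close>

lemma sum_adjacency_matrix_pos:
  fixes G :: "'n::finite pair_pre_digraph"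
  assumes "\<not> dangling G i" and "pverts G = UNIV"
  shows "(\<Sum>k\<in>UNIV. adjacency_matrix G $ i $ k) > 0"
proof -
  obtain k where "(i, k) \<in> parcs G"
    using assms by (auto simp: dangling_def out_arcs_def)
  then show ?thesis
    by (intro sum_pos2[of _ k]) (auto simp: adjacency_matrix_def)
qed

lemma row_stochastic_transition_matrix:
  fixes G :: "'n::finite pair_pre_digraph"
  assumes "\<And>i. \<not> dangling G i" and "pverts G = UNIV"
  shows "row_stochastic (transition_matrix G)"
proof -
  \<comment> \<open>At a dangling node the division by 0 would yield a zero row, whose sum is not
    1.\<close>
  have "(\<Sum>k\<in>UNIV. adjacency_matrix G $ i $ k) > 0" for i
    using assms by (intro sum_adjacency_matrix_pos)
  then show ?thesis
    by (auto simp: row_stochastic_def transition_matrix_def less_imp_neq[symmetric]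
        simp flip: sum_divide_distrib intro!: divide_nonneg_pos)
      (simp add: adjacency_matrix_def)
qed

lemma irreducible_transition_matrix:
  fixes G :: "'n::finite pair_pre_digraph"
  assumes "\<And>i. \<not> dangling G i" and "pverts G = UNIV"
    and "strongly_connected (with_proj G)"
  shows "irreducible_matrix (transition_matrix G)"
proof -
  have "(\<Sum>k\<in>UNIV. adjacency_matrix G $ i $ k) > 0" for i
    using assms by (intro sum_adjacency_matrix_pos)
  \<comment> \<open>Dividing the entry 1 of an arc by a positive row sum keeps it positive, so every
    path of the graph is a path of positive transition entries.\<close>
  then have "parcs G \<subseteq> {(i, j). transition_matrix G $ i $ j > 0}"
    by (auto simp: transition_matrix_def) (simp add: adjacency_matrix_def)
  then have "(parcs G)\<^sup>* \<subseteq> {(i, j). transition_matrix G $ i $ j > 0}\<^sup>*"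
    by (rule rtrancl_mono)
  moreover have "(i, j) \<in> (parcs G)\<^sup>*" for i j
    using assms(2,3) rtrancl_on_rtranclI[of i j UNIV "parcs G"]
    by (simp add: strongly_connected_def reachable_def)
  ultimately show ?thesis
    by (auto simp: irreducible_matrix_def)
qed

theorem corollary1:
  fixes G :: "'n::finite pair_pre_digraph" and l :: real
  assumes "pair_wf_digraph G" and "pverts G = UNIV"
    and "strongly_connected (with_proj G)"
    and "\<And>i. \<not> dangling G i"
    and "0 < l" and "l < 1"
  shows "pagerank G l \<in> open_simplex \<rightarrow> open_simplex \<and>
    (\<exists>!v. v \<in> open_simplex \<and> pagerank G l v = v) \<and>
    (\<forall>v \<in> open_simplex. pagerank G l v = v \<longrightarrow>
       is_left_perron_vector (transition_matrix G) v)"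
proof -
  let ?P = "transition_matrix G"
  have P: "row_stochastic ?P" "irreducible_matrix ?P"
    using assms by (intro row_stochastic_transition_matrix irreducible_transition_matrix; simp)+
  have fixed: "pagerank G l v = v \<longleftrightarrow> v v* ?P = v" for v
    by (rule pagerank_fixed_iff[OF P(1) assms(5,6)])
  have ex1: "\<exists>!v. v \<in> open_simplex \<and> v v* ?P = v"
    by (rule ex1_stationary_vector[OF P])
  have perron: "is_left_perron_vector ?P v" if "v \<in> open_simplex" "v v* ?P = v" for v
  proof -
    \<comment> \<open>As the spectral radius is 1, the Perron conditions describe exactly the
      stationary vectors in the simplex, so their uniqueness carries over.\<close>
    have "{p. p v* ?P = spectral_radius ?P *\<^sub>R p \<and> (\<forall>i. p $ i > 0) \<and> (\<Sum>i\<in>UNIV. p $ i) = 1}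
        = {p. p \<in> open_simplex \<and> p v* ?P = p}"
      by (auto simp: spectral_radius_row_stochastic[OF P(1)] open_simplex_def)
    also have "\<dots> = {v}"
      using ex1 that by blast
    finally show ?thesis
      by (simp add: is_left_perron_vector_def)
  qed
  show ?thesis
    unfolding fixed
    using pagerank_in_open_simplex[OF P(1) assms(5,6)] ex1 perron by blast
qed

end
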